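(* For $h\ge0$ let $\mathcal{P}_h(X)=\sum_{L\ge0}p(L,h)X^L$ (formal power series). Then $\mathcal{P}_0(X)=\dfrac{1}{1-X}$, $\mathcal{P}_1(X)=\dfrac{X}{1-X^2}$, and for all $h\ge2$, $$\mathcal{P}_h(X)=\frac{1}{1-X^{h+1}}\left(\sum_{L=0}^{h-1}p(L,h)X^L+\frac{X^h}{1-X^{h-1}}\sum_{r=0}^{h-2}p(h-1,r)X^r\right).$$
   Context: For a finite word $w$ over $\{0,1\}$, $|w|$ is its length and $|w|_0,|w|_1$ are its numbers of $0$'s and $1$'s; $|w|_1$ is the height of $w$. A subword means a contiguous factor. A word $w$ is balanced if for all finite subwords $u,v$ of $w$ with $|u|=|v|$ one has $\bigl||u|_0-|v|_0\bigr|\le 1$. For $0\le h\le L$, $\mathbb{P}(L,h)$ is the set of balanced palindromes in $\{0,1\}^*$ of length $L$ and height $h$. The function $p:\mathbb{Z}^2\to\mathbb{N}$ is defined by $p(L,h)=\#\mathbb{P}(L,h\bmod L)$ if $L>0$ (with $h\bmod L\in\{0,\dots,L-1\}$), $p(0,0)=1$, and $p(L,h)=0$ if $L<0$ or if $L=0$ and $h\ne0$. *)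

theory Defs
  imports Complex_Main "HOL-Library.Sublist"
    "HOL-Computational_Algebra.Formal_Power_Series"
begin

(* Words over {0,1} are the elements of lists {0, 1}; subwords are contiguous factors. *)

definition balanced :: "nat list \<Rightarrow> bool" where
  "balanced w \<longleftrightarrow> (\<forall>u v. sublist u w \<longrightarrow> sublist v w \<longrightarrow> length u = length v \<longrightarrow>
     \<bar>int (count_list u 0) - int (count_list v 0)\<bar> \<le> 1)"

definition balanced_palindromes :: "nat \<Rightarrow> nat \<Rightarrow> nat list set" where
  "balanced_palindromes L h =
     {w \<in> lists {0, 1}. balanced w \<and> rev w = w \<and> length w = L \<and> count_list w 1 = h}"

definition p :: "int \<Rightarrow> int \<Rightarrow> nat" where
  "p L h =
     (if L > 0 then card (balanced_palindromes (nat L) (nat (h mod L)))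
      else if L = 0 \<and> h = 0 then 1 else 0)"

(* The integer power series is viewed over the rationals so that division is available. *)

definition pal_series :: "nat \<Rightarrow> rat fps" where
  "pal_series h = Abs_fps (\<lambda>L. of_nat (p (int L) (int h)))"

end

theory Submission imports Defs begin

text \<open>
  A palindrome that starts (hence ends) with \<open>1\<close> is determined by the list of gaps between its
  consecutive ones, and it is balanced iff the sums of equally many consecutive gaps differ by at
  most one. Then all gaps lie in \<open>{k, k + 1}\<close>, so subtracting \<open>k\<close> leaves a balanced palindrome of
  length \<open>h - 1\<close> over \<open>{0, 1}\<close>. Counting the palindromes that start with \<open>0\<close> in the same way after
  exchanging the letters gives \<open>p(L, h) = p(h - 1, L - h) + p(L - h - 1, h)\<close> for \<open>0 \<le> h \<le> L\<close>,
  \<open>L \<noteq> 0\<close>, from which the three series are read off.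
\<close>

section \<open>Balanced lists of numbers\<close>

text \<open>Differences of prefix sums are window sums; the additive form avoids truncated
  subtraction, and exchanging \<open>i\<close> and \<open>j\<close> supplies the absolute value.
  Entries may be arbitrary naturals, so lists of gaps are covered too.\<close>

definition sum_balanced :: "nat list \<Rightarrow> bool" where
  "sum_balanced w \<longleftrightarrow> (\<forall>i j m. i + m \<le> length w \<longrightarrow> j + m \<le> length w \<longrightarrow>
     sum_list (take (i + m) w) + sum_list (take j w)
       \<le> sum_list (take (j + m) w) + sum_list (take i w) + 1)"

lemma sum_balancedD:
  assumes "sum_balanced w" "i + m \<le> length w" "j + m \<le> length w"
  shows "sum_list (take (i + m) w) + sum_list (take j w)
       \<le> sum_list (take (j + m) w) + sum_list (take i w) + 1"
  using assms unfolding sum_balanced_def by blast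

lemma count_list_1_eq_sum_list: "w \<in> lists {0, 1::nat} \<Longrightarrow> count_list w 1 = sum_list w"
  by (induction w) auto

lemma count_list_0_plus_sum_list:
  "w \<in> lists {0, 1::nat} \<Longrightarrow> count_list w 0 + sum_list w = length w"
  by (induction w) auto

lemma sum_list_take_add:
  "sum_list (take (i + m) w) = sum_list (take i w) + sum_list (take m (drop i w))"
  for w :: "nat list"
  by (simp add: take_add)

text \<open>Windows are sublists, and a 0/1 window of length \<open>m\<close> has \<open>m\<close>
  minus its sum many zeros, so differences of zero counts and of sums agree up to sign.\<close>

lemma balanced_iff_sum_balanced:
  assumes "w \<in> lists {0, 1}"
  shows "balanced w \<longleftrightarrow> sum_balanced w"
proof
  assume bal: "balanced w"
  show "sum_balanced w"
    unfolding sum_balanced_def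
  proof (intro allI impI)
    fix i j m assume le: "i + m \<le> length w" "j + m \<le> length w"
    let ?u = "take m (drop i w)" and ?v = "take m (drop j w)"
    have sub: "sublist ?u w" "sublist ?v w"
      by (metis append_take_drop_id sublist_appendI)+
    have len: "length ?u = m" "length ?v = m" using le by auto
    have "?u \<in> lists {0, 1}" "?v \<in> lists {0, 1}"
      using assms by (auto dest!: in_set_takeD in_set_dropD)
    then have "count_list ?u 0 + sum_list ?u = m" "count_list ?v 0 + sum_list ?v = m"
      using len by (metis count_list_0_plus_sum_list)+
    moreover have "\<bar>int (count_list ?u 0) - int (count_list ?v 0)\<bar> \<le> 1"
      using bal sub len unfolding balanced_def by simp
    ultimately show "sum_list (take (i + m) w) + sum_list (take j w)
       \<le> sum_list (take (j + m) w) + sum_list (take i w) + 1"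
      unfolding sum_list_take_add by linarith
  qed
next
  assume bal: "sum_balanced w"
  have one_sided: "count_list u 0 \<le> count_list v 0 + 1"
    if uv: "sublist u w" "sublist v w" and len: "length u = length v" for u v
  proof -
    obtain a b where u: "w = a @ u @ b" using uv(1) by (auto simp: sublist_def)
    obtain c d where v: "w = c @ v @ d" using uv(2) by (auto simp: sublist_def)
    have "u \<in> lists {0, 1}" using assms unfolding u by auto
    then have "count_list u 0 + sum_list u = length u" by (rule count_list_0_plus_sum_list)
    moreover have "v \<in> lists {0, 1}" using assms unfolding v by auto
    then have "count_list v 0 + sum_list v = length v" by (rule count_list_0_plus_sum_list)
    moreover have "take (length u) (drop (length a) w) = u" unfolding u by simp
    moreover have "take (length u) (drop (length c) w) = v" unfolding v by (simp add: len)
    moreover have "length a + length u \<le> length w" unfolding u by simp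
    moreover have "length c + length u \<le> length w" unfolding v by (simp add: len)
    ultimately show ?thesis
      \<comment> \<open>More zeros means a smaller sum, so the window of \<open>v\<close> takes the
        first place.\<close>
      using sum_balancedD[OF bal, of "length c" "length u" "length a"] len
      unfolding sum_list_take_add by simp
  qed
  show "balanced w"
    unfolding balanced_def
  proof (intro allI impI)
    fix u v assume "sublist u w" "sublist v w" "length u = length v"
    then show "\<bar>int (count_list u 0) - int (count_list v 0)\<bar> \<le> 1"
      using one_sided[of u v] one_sided[of v u] by simp
  qed
qed

section \<open>Adding a constant and exchanging the letters\<close>

lemma sum_list_map_add: "sum_list (map ((+) k) v) = k * length v + sum_list v" for v :: "nat list"
  by (induction v) auto

text \<open>Both windows have length \<open>m\<close>, so both sums grow by \<open>k * m\<close>,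
  which cancels.\<close>

lemma sum_balanced_map_add: "sum_balanced (map ((+) k) v) \<longleftrightarrow> sum_balanced v"
proof -
  have "sum_list (take i (map ((+) k) v)) = k * i + sum_list (take i v)" if "i \<le> length v" for i
    using that by (simp add: take_map sum_list_map_add)
  then show ?thesis
    unfolding sum_balanced_def length_map
    by (intro iff_allI imp_cong refl) (simp add: algebra_simps)
qed

lemma sum_list_map_minus:
  assumes "w \<in> lists {0, 1::nat}"
  shows "sum_list (map ((-) 1) w) + sum_list w = length w"
  using assms by (induction w) auto

text \<open>A window sum \<open>s\<close> becomes \<open>m - s\<close>. This reverses the
  inequality, so the hypothesis is used with \<open>i\<close> and \<open>j\<close>
  exchanged.\<close>

lemma sum_balanced_map_minus:
  assumes "w \<in> lists {0, 1}" "sum_balanced w"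
  shows "sum_balanced (map ((-) 1) w)"
  unfolding sum_balanced_def
proof (intro allI impI)
  have sum: "sum_list (take i (map ((-) 1) w)) + sum_list (take i w) = i" if "i \<le> length w" for i
  proof -
    have "take i w \<in> lists {0, 1}" using assms(1) by (auto dest: in_set_takeD)
    from sum_list_map_minus[OF this] that show ?thesis by (simp add: take_map)
  qed
  fix i j m assume "i + m \<le> length (map ((-) 1) w)" "j + m \<le> length (map ((-) 1) w)"
  then show "sum_list (take (i + m) (map ((-) 1) w)) + sum_list (take j (map ((-) 1) w))
       \<le> sum_list (take (j + m) (map ((-) 1) w)) + sum_list (take i (map ((-) 1) w)) + 1"
    using sum_balancedD[OF assms(2), of j m i] sum[of i] sum[of j] sum[of "i + m"] sum[of "j + m"]
    by simp
qed

lemma sum_balanced_diff_le_1: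
  assumes "sum_balanced as" "a \<in> set as" "b \<in> set as"
  shows "a \<le> b + 1"
proof -
  obtain i j where ij: "i < length as" "as ! i = a" "j < length as" "as ! j = b"
    using assms(2,3) by (auto simp: in_set_conv_nth)
  then show ?thesis
    using sum_balancedD[OF assms(1), of i 1 j] by (simp add: take_Suc_conv_app_nth)
qed

section \<open>Words given by their gaps\<close>

text \<open>A list of \<open>n\<close> gaps codes \<open>n + 1\<close> ones: the closing
  \<open>[1]\<close> bounds the last gap, and the empty list codes a one-letter word.\<close>

definition gap_word :: "nat list \<Rightarrow> nat list" where
  "gap_word as = concat (map (\<lambda>a. 1 # replicate a 0) as) @ [1]"

lemma gap_word_Nil [simp]: "gap_word [] = [1]"
  by (simp add: gap_word_def)

lemma gap_word_Cons [simp]: "gap_word (a # as) = 1 # replicate a 0 @ gap_word as"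
  by (simp add: gap_word_def)

lemma length_gap_word: "length (gap_word as) = length as + sum_list as + 1"
  by (induction as) auto

lemma sum_list_gap_word: "sum_list (gap_word as) = length as + 1"
  by (induction as) (auto simp: sum_list_replicate)

lemma gap_word_in_lists: "gap_word as \<in> lists {0, 1}"
  by (induction as) auto

lemma hd_gap_word [simp]: "hd (gap_word as) = 1"
  by (cases as) auto

lemma gap_word_neq_Nil [simp]: "gap_word as \<noteq> []"
  by (cases as) auto

lemma gap_word_neq_0_Cons [simp]: "gap_word as \<noteq> 0 # xs" "0 # xs \<noteq> gap_word as"
  by (cases as; simp)+

lemma replicate_append_gap_word_inject:
  "replicate a 0 @ gap_word as = replicate b 0 @ gap_word bs \<longleftrightarrow> a = b \<and> gap_word as = gap_word bs"
proof (induction a arbitrary: b)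
  case 0
  then show ?case by (cases b) simp_all
next
  case (Suc a)
  then show ?case by (cases b) simp_all
qed

lemma gap_word_inject: "gap_word as = gap_word bs \<longleftrightarrow> as = bs"
proof (induction as arbitrary: bs)
  case Nil
  then show ?case by (cases bs) simp_all
next
  case (Cons a as)
  then show ?case by (cases bs) (simp_all add: replicate_append_gap_word_inject)
qed

lemma gap_word_append: "gap_word (as @ [a]) = gap_word as @ replicate a 0 @ [1]"
  by (simp add: gap_word_def)

text \<open>With injectivity, this makes \<open>gap_word as\<close> a palindrome exactly when
  \<open>as\<close> is one.\<close>

lemma rev_gap_word: "rev (gap_word as) = gap_word (rev as)"
  by (induction as) (simp_all add: gap_word_append)

lemma word_eq_gap_word:
  assumes "w \<in> lists {0, 1}" "w \<noteq> []" "hd w = 1" "last w = 1"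
  shows "\<exists>as. w = gap_word as"
proof -
  \<comment> \<open>Removing the first letter may leave a word that starts with 0, so the induction
    admits a leading block of zeros.\<close>
  have decomp: "\<exists>a as. v @ [1] = replicate a 0 @ gap_word as" if "v \<in> lists {0, 1}" for v
    using that
  proof (induction v)
    case Nil
    have "[] @ [1] = replicate 0 0 @ gap_word []" by simp
    then show ?case by blast
  next
    case (Cons x v)
    then obtain a as where v: "v @ [1] = replicate a 0 @ gap_word as" by auto
    consider "x = 0" | "x = 1" using Cons.hyps by auto
    then show ?case
    proof cases
      case 1
      then have "(x # v) @ [1] = replicate (Suc a) 0 @ gap_word as" using v by simp
      then show ?thesis by blast
    next
      case 2
      \<comment> \<open>The leading block of \<open>a\<close> zeros becomes the first gap.\<close>
      then have "(x # v) @ [1] = replicate 0 0 @ gap_word (a # as)" using v by simp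
      then show ?thesis by blast
    qed
  qed
  have "butlast w \<in> lists {0, 1}" using assms(1) by (auto dest: in_set_butlastD)
  from decomp[OF this] obtain a as where w: "w = replicate a 0 @ gap_word as"
    using append_butlast_last_id[OF assms(2)] assms(4) by auto
  with assms(3) have "a = 0" by (cases a) auto
  with w show ?thesis by auto
qed

section \<open>Positions of the ones in a gap word\<close>

lemma sum_list_take_mono: "i \<le> j \<Longrightarrow> sum_list (take i w) \<le> sum_list (take j w)" for w :: "nat list"
  by (auto simp: le_iff_add sum_list_take_add)

text \<open>
  The \<open>j\<close>-th one of \<open>gap_word as\<close> stands at position \<open>j + sum_list (take j as)\<close>, so
  counting the ones in a prefix and locating a one are adjoint to each other.
\<close>

lemma take_gap_word:
  assumes "j \<le> length as"
  shows "\<exists>u v. gap_word as = u @ 1 # v \<and> length u = j + sum_list (take j as) \<and> sum_list u = j"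
  using assms
proof (induction as arbitrary: j)
  case Nil
  then show ?case by auto
next
  case (Cons a as)
  show ?case
  proof (cases j)
    case 0
    then show ?thesis by auto
  next
    case (Suc i)
    with Cons.IH[of i] Cons.prems obtain u v where
      "gap_word as = u @ 1 # v" "length u = i + sum_list (take i as)" "sum_list u = i"
      by auto
    then have "gap_word (a # as) = (1 # replicate a 0 @ u) @ 1 # v"
      "length (1 # replicate a 0 @ u) = j + sum_list (take j (a # as))"
      "sum_list (1 # replicate a 0 @ u) = j"
      using Suc by (auto simp: sum_list_replicate)
    then show ?thesis by blast
  qed
qed

lemma ones_before_position_le:
  assumes "j \<le> length as" "x \<le> j + sum_list (take j as)"
  shows "sum_list (take x (gap_word as)) \<le> j"
proof -
  obtain u v where "gap_word as = u @ 1 # v" "length u = j + sum_list (take j as)" "sum_list u = j"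
    using take_gap_word[OF assms(1)] by blast
  then show ?thesis
    using sum_list_take_mono[OF assms(2), of "gap_word as"] by simp
qed

lemma ones_after_position_gt:
  assumes "j \<le> length as" "j + sum_list (take j as) < x"
  shows "j < sum_list (take x (gap_word as))"
proof -
  obtain u v where "gap_word as = u @ 1 # v" "length u = j + sum_list (take j as)" "sum_list u = j"
    using take_gap_word[OF assms(1)] by blast
  then show ?thesis
    using sum_list_take_mono[of "Suc (j + sum_list (take j as))" x "gap_word as"] assms(2) by simp
qed

text \<open>\<open>C x\<close> counts the ones among the first \<open>x\<close> letters and
  \<open>pos j\<close> locates the one with index \<open>j\<close>. Each direction turns a violation
  in one list into a violation in the other.\<close>

lemma sum_balanced_gap_word: "sum_balanced (gap_word as) \<longleftrightarrow> sum_balanced as"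
proof -
  define w where "w = gap_word as"
  define n where "n = length as"
  define C where "C x = sum_list (take x w)" for x
  define pos where "pos j = j + sum_list (take j as)" for j
  have C_le: "C x \<le> j" if "j \<le> n" "x \<le> pos j" for j x
    using ones_before_position_le that by (simp add: C_def pos_def n_def w_def)
  have C_gt: "j < C x" if "j \<le> n" "pos j < x" for j x
    using ones_after_position_gt that by (simp add: C_def pos_def n_def w_def)
  have pos_less: "pos i < pos j" if "i < j" for i j
    using that sum_list_take_mono[of i j as] by (simp add: pos_def)
  have pos_0: "pos 0 = 0" by (simp add: pos_def)
  have len: "length w = pos n + 1" by (simp add: w_def pos_def n_def length_gap_word)
  have C_bound: "C x \<le> n + 1" for x
    using sum_list_take_mono[of x "max x (length w)" w] sum_list_gap_word[of as]
    by (simp add: C_def w_def n_def)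
  have "sum_balanced as" if bal: "sum_balanced w"
    unfolding sum_balanced_def
  proof (intro allI impI, rule ccontr)
    fix i j m
    assume le: "i + m \<le> length as" "j + m \<le> length as"
      and "\<not> sum_list (take (i + m) as) + sum_list (take j as)
             \<le> sum_list (take (j + m) as) + sum_list (take i as) + 1"
    then have gt: "pos (i + m) + pos j \<ge> pos (j + m) + pos i + 2" by (simp add: pos_def)
    \<comment> \<open>The window of length \<open>l\<close> at \<open>pos j\<close> contains the
      \<open>m + 1\<close> ones \<open>j, ..., j + m\<close>. The one at \<open>pos i + 1\<close>
      ends by \<open>pos (i + m)\<close>, so it lies strictly between the ones \<open>i\<close> and
      \<open>i + m\<close> and has at most \<open>m - 1\<close> ones.\<close>
    define l where "l = pos (j + m) - pos j + 1"
    have mono: "pos j \<le> pos (j + m)" using pos_less[of j "j + m"] by (cases "m = 0") auto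
    have i_le: "pos (i + m) \<le> pos n" using pos_less[of "i + m" n] le
      by (cases "i + m = n") (auto simp: n_def)
    have j_le: "pos (j + m) \<le> pos n" using pos_less[of "j + m" n] le
      by (cases "j + m = n") (auto simp: n_def)
    have "C (pos j + l) + C (pos i + 1) \<le> C (pos i + 1 + l) + C (pos j) + 1"
      unfolding C_def
      by (rule sum_balancedD[OF bal]) (use i_le j_le gt mono len l_def in auto)
    moreover have "j + m < C (pos j + l)" by (rule C_gt) (use le mono l_def n_def in auto)
    moreover have "i < C (pos i + 1)" by (rule C_gt) (use le n_def in auto)
    moreover have "C (pos i + 1 + l) \<le> i + m" by (rule C_le) (use le gt mono l_def n_def in auto)
    moreover have "C (pos j) \<le> j" by (rule C_le) (use le n_def in auto)
    ultimately show False by simp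
  qed
  moreover have "sum_balanced w" if bal: "sum_balanced as"
    unfolding sum_balanced_def
  proof (intro allI impI, rule ccontr)
    fix y x l
    assume le: "y + l \<le> length w" "x + l \<le> length w"
      and "\<not> sum_list (take (y + l) w) + sum_list (take x w)
             \<le> sum_list (take (x + l) w) + sum_list (take y w) + 1"
    then have gt: "C (y + l) + C x \<ge> C (x + l) + C y + 2" by (simp add: C_def)
    have mono: "C x \<le> C (x + l)" unfolding C_def by (rule sum_list_take_mono) simp
    define i where "i = C x"
    define j where "j = C y"
    \<comment> \<open>The window at \<open>x\<close> has \<open>m - 1\<close> ones, the window at
      \<open>y\<close> at least \<open>m + 1\<close>. The latter contains the ones \<open>j\<close>
      and \<open>j + m\<close>, whose distance is thus at most \<open>l - 1\<close>; by balance any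
      ones \<open>a\<close> and \<open>a + m\<close> are at distance at most
      \<open>l\<close>.\<close>
    define m where "m = C (x + l) - C x + 1"
    have jm: "j + m \<le> n" "j + m < C (y + l)"
      using gt mono C_bound[of "y + l"] by (auto simp: j_def m_def)
    have y: "y \<le> pos j" using C_gt[of j y] jm by (force simp: j_def)
    have yl: "pos (j + m) < y + l" using C_le[of "j + m" "y + l"] jm by force
    have bal': "pos (a + m) + pos j \<le> pos (j + m) + pos a + 1" if "a + m \<le> n" for a
      using sum_balancedD[OF bal, of a m j] that jm by (simp add: pos_def n_def)
    \<comment> \<open>it suffices to find \<open>m\<close> consecutive gaps whose ones enclose the window \<open>[x, x + l)\<close>\<close>
    have False if "a + m \<le> n" "pos a + l + 1 \<le> pos (a + m)" for a
      using bal'[OF that(1)] that(2) y yl by simp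
    moreover have "\<exists>a. a + m \<le> n \<and> pos a + l + 1 \<le> pos (a + m)"
    \<comment> \<open>In general the ones \<open>i - 1\<close> and \<open>i - 1 + m\<close> flank
      the window at \<open>x\<close>. The exceptions are windows at either end of the word.\<close>
    proof (cases "i = 0")
      case True
      then have "x = 0" using C_gt[of 0 x] pos_0 by (force simp: i_def)
      moreover have "x + l \<le> pos (m - 1)"
        using C_gt[of "m - 1" "x + l"] jm True by (force simp: i_def m_def)
      moreover have "pos (m - 1) < pos m" by (rule pos_less) (simp add: m_def)
      ultimately have "0 + m \<le> n \<and> pos 0 + l + 1 \<le> pos (0 + m)" using jm pos_0 by simp
      then show ?thesis by blast
    next
      case False
      have "i \<le> n + 1" using C_bound by (simp add: i_def)
      then have x: "pos (i - 1) < x" using C_le[of "i - 1" x] False by (force simp: i_def)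
      have im: "C (x + l) = i - 1 + m" using mono False by (simp add: i_def m_def)
      show ?thesis
      proof (cases "i - 1 + m \<le> n")
        case True
        then have "x + l \<le> pos (i - 1 + m)" using C_gt[of "i - 1 + m" "x + l"] im by force
        then have "i - 1 + m \<le> n \<and> pos (i - 1) + l + 1 \<le> pos (i - 1 + m)" using True x by simp
        then show ?thesis by blast
      next
        case False
        \<comment> \<open>The window reaches the end of the word. Here \<open>n - m = i - 2\<close>,
          so the one \<open>n - m\<close> stands at least two positions before \<open>x\<close>,
          which compensates for the last one lying inside the window.\<close>
        then have eq: "i - 1 + m = n + 1" using C_bound[of "x + l"] im by simp
        then have "pos (n - m) < pos (i - 1)" using jm by (intro pos_less) simp
        then have "n - m + m \<le> n \<and> pos (n - m) + l + 1 \<le> pos (n - m + m)"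
          using x jm le len by simp
        then show ?thesis by blast
      qed
    qed
    ultimately show False by blast
  qed
  ultimately show ?thesis unfolding w_def by blast
qed

section \<open>The recurrence\<close>

definition gap_palindromes :: "nat \<Rightarrow> nat \<Rightarrow> nat list set" where
  "gap_palindromes n s = {as. sum_balanced as \<and> rev as = as \<and> length as = n \<and> sum_list as = s}"

lemma balanced_palindromes_altdef:
  "balanced_palindromes L h =
     {w \<in> lists {0, 1}. sum_balanced w \<and> rev w = w \<and> length w = L \<and> sum_list w = h}"
  unfolding balanced_palindromes_def
  by (intro Collect_cong conj_cong refl)
    (simp_all add: balanced_iff_sum_balanced count_list_1_eq_sum_list del: One_nat_def)

lemma finite_balanced_palindromes: "finite (balanced_palindromes L h)"
  by (rule finite_subset[OF _ finite_lists_length_eq[of "{0, 1::nat}" L]])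
    (auto simp: balanced_palindromes_altdef)

text \<open>Subtracting the least gap \<open>k\<close> leaves a 0/1 word. The quotient and remainder
  of \<open>s\<close> by \<open>n\<close> then determine \<open>k\<close> and the height of that
  word; this is how the reduction modulo the length in \<open>p\<close> arises.\<close>

lemma gap_palindromes_eq_image:
  assumes "n > 0"
  shows "gap_palindromes n s = map ((+) (s div n)) ` balanced_palindromes n (s mod n)"
proof (intro equalityI subsetI)
  fix as assume "as \<in> gap_palindromes n s"
  then have as: "sum_balanced as" "rev as = as" "length as = n" "sum_list as = s"
    by (auto simp: gap_palindromes_def)
  define k where "k = Min (set as)"
  define v where "v = map (\<lambda>a. a - k) as"
  have ne: "as \<noteq> []" using as(3) assms by auto
  have k: "k \<in> set as" unfolding k_def using ne by (intro Min_in) auto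
  have k_le: "k \<le> a" if "a \<in> set as" for a unfolding k_def using that by simp
  have as_v: "as = map ((+) k) v" unfolding v_def map_map by (rule map_idI[symmetric]) (simp add: k_le)
  have len_v: "length v = n" using as(3) by (simp add: v_def)
  have v: "v \<in> lists {0, 1}"
  proof -
    have "a - k = 0 \<or> a - k = 1" if "a \<in> set as" for a
      using sum_balanced_diff_le_1[OF as(1) that k] k_le[OF that] by linarith
    then show ?thesis by (fastforce simp: v_def)
  qed
  \<comment> \<open>The minimum is attained, so \<open>v\<close> has a zero and its sum is a genuine
    remainder modulo \<open>n\<close>.\<close>
  have "0 \<in> set v" using k by (force simp: v_def)
  then have "count_list v 0 \<noteq> 0" by (simp add: count_list_0_iff)
  then have less: "sum_list v < n" using count_list_0_plus_sum_list[OF v] len_v by simp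
  have "s = k * n + sum_list v" using as(4) sum_list_map_add[of k v] len_v by (simp flip: as_v)
  then have kr: "s div n = k" "s mod n = sum_list v" using less by auto
  have "sum_balanced v" using as(1) sum_balanced_map_add[of k v] by (simp flip: as_v)
  moreover have "rev v = v" using as(2) by (simp add: v_def rev_map)
  ultimately have "v \<in> balanced_palindromes n (s mod n)"
    using v len_v kr by (simp add: balanced_palindromes_altdef)
  then show "as \<in> map ((+) (s div n)) ` balanced_palindromes n (s mod n)"
    using as_v kr by blast
next
  fix as assume "as \<in> map ((+) (s div n)) ` balanced_palindromes n (s mod n)"
  then show "as \<in> gap_palindromes n s"
    by (auto simp: gap_palindromes_def balanced_palindromes_altdef sum_balanced_map_add
        sum_list_map_add rev_map)
qed

lemma card_gap_palindromes: "card (gap_palindromes n s) = p (int n) (int s)"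
proof (cases "n = 0")
  case True
  \<comment> \<open>Only the empty list has no gaps, which matches the special values of
    \<open>p\<close> at first argument 0.\<close>
  then have "gap_palindromes n s = (if s = 0 then {[]} else {})"
    by (auto simp: gap_palindromes_def sum_balanced_def)
  then show ?thesis using True by (simp add: p_def)
next
  case False
  then have "card (gap_palindromes n s) = card (balanced_palindromes n (s mod n))"
    by (simp add: gap_palindromes_eq_image card_image inj_on_mapI)
  then show ?thesis using False by (simp add: p_def flip: zmod_int)
qed

text \<open>A palindrome starting with 1 also ends with 1, so its \<open>h\<close> ones enclose
  \<open>h - 1\<close> gaps containing all \<open>L - h\<close> zeros.\<close>

lemma balanced_palindromes_hd_1:
  assumes "1 \<le> h" "h \<le> L"
  shows "{w \<in> balanced_palindromes L h. hd w = 1} = gap_word ` gap_palindromes (h - 1) (L - h)"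
proof (intro equalityI subsetI)
  fix w assume "w \<in> {w \<in> balanced_palindromes L h. hd w = 1}"
  then have w: "w \<in> lists {0, 1}" "sum_balanced w" "rev w = w" "length w = L" "sum_list w = h" "hd w = 1"
    by (auto simp: balanced_palindromes_altdef)
  have ne: "w \<noteq> []" using w(4) assms by auto
  moreover have "last w = 1" using w(3,6) ne by (metis hd_rev)
  ultimately obtain as where as: "w = gap_word as" using word_eq_gap_word w by blast
  have "as \<in> gap_palindromes (h - 1) (L - h)"
    using w as by (auto simp: gap_palindromes_def sum_balanced_gap_word rev_gap_word gap_word_inject
        length_gap_word sum_list_gap_word)
  then show "w \<in> gap_word ` gap_palindromes (h - 1) (L - h)" using as by blast
next
  fix w assume "w \<in> gap_word ` gap_palindromes (h - 1) (L - h)"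
  then obtain as where "as \<in> gap_palindromes (h - 1) (L - h)" "w = gap_word as" by blast
  then show "w \<in> {w \<in> balanced_palindromes L h. hd w = 1}"
    using assms gap_word_in_lists[of as]
    by (simp add: gap_palindromes_def balanced_palindromes_altdef sum_balanced_gap_word
        rev_gap_word length_gap_word sum_list_gap_word)
qed

lemma card_balanced_palindromes_hd_1:
  assumes "h \<le> L" "L > 0"
  shows "card {w \<in> balanced_palindromes L h. hd w = 1} = p (int h - 1) (int L - int h)"
proof (cases "h = 0")
  case True
  \<comment> \<open>Without ones the set is empty, in agreement with the default value of
    \<open>p\<close> at first argument -1.\<close>
  have "hd w \<noteq> 1" if "w \<in> balanced_palindromes L h" for w
    using that True assms by (cases w) (auto simp: balanced_palindromes_altdef)
  then have "{w \<in> balanced_palindromes L h. hd w = 1} = {}" by blast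
  then show ?thesis using True by (simp only: card.empty) (simp add: p_def)
next
  case False
  then have "card {w \<in> balanced_palindromes L h. hd w = 1} = card (gap_palindromes (h - 1) (L - h))"
    using assms by (subst balanced_palindromes_hd_1) (simp_all add: card_image inj_on_def gap_word_inject)
  then show ?thesis using False assms by (simp add: card_gap_palindromes of_nat_diff)
qed

section \<open>Palindromes starting with 0, by exchange of the letters\<close>

lemma map_minus_balanced_palindromes:
  assumes "w \<in> balanced_palindromes L h"
  shows "map ((-) 1) w \<in> balanced_palindromes L (L - h)" "map ((-) 1) (map ((-) 1) w) = w"
proof -
  have w: "w \<in> lists {0, 1}" "sum_balanced w" "rev w = w" "length w = L" "sum_list w = h"
    using assms by (auto simp: balanced_palindromes_altdef)
  have "map ((-) 1) w \<in> lists {0, 1}" by auto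
  then show "map ((-) 1) w \<in> balanced_palindromes L (L - h)"
    using w sum_balanced_map_minus[of w] sum_list_map_minus[of w]
    by (auto simp: balanced_palindromes_altdef rev_map)
  show "map ((-) 1) (map ((-) 1) w) = w"
    using w(1) by (auto intro!: map_idI)
qed

lemma bij_betw_map_minus:
  assumes "h \<le> L"
  shows "bij_betw (map ((-) 1)) (balanced_palindromes L h) (balanced_palindromes L (L - h))"
  by (rule bij_betw_byWitness[where f' = "map ((-) 1)"])
    (use assms map_minus_balanced_palindromes[of _ L h] map_minus_balanced_palindromes[of _ L "L - h"]
      in auto)

text \<open>Exchanging the letters gives palindromes of height \<open>L - h\<close> that start with
  1; their \<open>L - h - 1\<close> gaps have sum \<open>h\<close>.\<close>

lemma card_balanced_palindromes_hd_0:
  assumes "h \<le> L" "L > 0"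
  shows "card {w \<in> balanced_palindromes L h. hd w = 0} = p (int L - int h - 1) (int h)"
proof -
  have hd: "hd (map ((-) 1) w) = 1 - hd w" if "w \<in> balanced_palindromes L h'" for w h'
    using that assms by (cases w) (auto simp: balanced_palindromes_altdef)
  have "bij_betw (map ((-) 1)) {w \<in> balanced_palindromes L h. hd w = 0}
          {w \<in> balanced_palindromes L (L - h). hd w = 1}"
    by (rule bij_betw_byWitness[where f' = "map ((-) 1)"])
      (use assms map_minus_balanced_palindromes[of _ L h]
        map_minus_balanced_palindromes[of _ L "L - h"] hd in auto)
  then have "card {w \<in> balanced_palindromes L h. hd w = 0}
               = card {w \<in> balanced_palindromes L (L - h). hd w = 1}"
    by (rule bij_betw_same_card)
  then show ?thesis using card_balanced_palindromes_hd_1[of "L - h" L] assms by (simp add: of_nat_diff)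
qed

text \<open>For \<open>h = L\<close> the reduction modulo \<open>L\<close> makes \<open>p\<close>
  count height 0 instead; exchanging the letters shows that the counts agree.\<close>

lemma p_eq_card:
  assumes "h \<le> L" "L > 0"
  shows "p (int L) (int h) = card (balanced_palindromes L h)"
proof (cases "h = L")
  case True
  then show ?thesis
    using bij_betw_same_card[OF bij_betw_map_minus[of L L]] assms by (simp add: p_def)
next
  case False
  then show ?thesis using assms by (simp add: p_def)
qed

text \<open>Split by the first letter. For \<open>h = 0\<close> or \<open>h = L\<close> one summand
  has first argument -1 and vanishes.\<close>

lemma p_recurrence:
  assumes "h \<le> L" "L > 0"
  shows "p (int L) (int h) = p (int h - 1) (int L - int h) + p (int L - int h - 1) (int h)"
proof -
  have "hd w = 0 \<or> hd w = 1" if "w \<in> balanced_palindromes L h" for w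
    using that assms by (cases w) (auto simp: balanced_palindromes_altdef)
  then have "balanced_palindromes L h
      = {w \<in> balanced_palindromes L h. hd w = 1} \<union> {w \<in> balanced_palindromes L h. hd w = 0}"
    by blast
  then have "card (balanced_palindromes L h)
      = card {w \<in> balanced_palindromes L h. hd w = 1} + card {w \<in> balanced_palindromes L h. hd w = 0}"
    by (subst card_Un_disjoint[symmetric]) (auto simp: finite_balanced_palindromes)
  then show ?thesis
    using assms card_balanced_palindromes_hd_1[of h L] card_balanced_palindromes_hd_0[of h L]
    by (simp add: p_eq_card)
qed

lemma p_neg: "L < 0 \<Longrightarrow> p L h = 0"
  by (simp add: p_def)

text \<open>This periodicity produces the denominator \<open>1 - fps_X ^ (h - 1)\<close>.\<close>

lemma p_minus_period:
  assumes "n > 0"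
  shows "p n (s - n) = p n s"
  using assms by (simp add: p_def)

section \<open>The generating functions\<close>

lemma fps_eq_divideI: "f * g = a \<Longrightarrow> g \<noteq> 0 \<Longrightarrow> f = a / g" for f g a :: "'a::field fps"
  by auto

lemma fps_eq_mult_inverseI:
  "f * g = a \<Longrightarrow> fps_nth g 0 \<noteq> 0 \<Longrightarrow> f = a * inverse g" for f g a :: "'a::field fps"
  by (auto simp: mult.assoc inverse_mult_eq_1')

lemma one_minus_fps_X_power_neq_0: "n > 0 \<Longrightarrow> 1 - fps_X ^ n \<noteq> (0 :: 'a::field fps)"
  by (auto dest!: arg_cong[where f = "\<lambda>f. fps_nth f 0"])

text \<open>The identities are checked coefficientwise after clearing denominators, where each such
  factor becomes a difference with lag \<open>m\<close>.\<close>

lemma fps_nth_mult_one_minus_X_power: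
  "fps_nth (f * (1 - fps_X ^ m)) n = fps_nth f n - (if n < m then 0 else fps_nth f (n - m))"
  for f :: "'a::comm_ring_1 fps"
  by (simp add: algebra_simps fps_X_power_mult_right_nth)

lemma fps_nth_sum_monomials:
  "fps_nth (\<Sum>i = 0..k. of_nat (c i) * fps_X ^ i) n = (if n \<le> k then of_nat (c n) else 0)"
  for n :: nat
proof -
  have "fps_nth (of_nat a * fps_X ^ i :: 'a fps) n = (if n = i then of_nat a else 0)" for a i
    by (simp flip: fps_of_nat)
  then show ?thesis by (simp add: fps_sum_nth)
qed

lemma pal_series_0: "pal_series 0 = 1 / (1 - fps_X)"
proof (rule fps_eq_divideI)
  show "pal_series 0 * (1 - fps_X) = 1"
  proof (rule fps_ext)
    fix L
    show "fps_nth (pal_series 0 * (1 - fps_X)) L = fps_nth 1 L"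
      \<comment> \<open>For \<open>h = 0\<close> the recurrence reads
        \<open>p L 0 = p (L - 1) 0\<close> when \<open>L > 0\<close>.\<close>
      using fps_nth_mult_one_minus_X_power[of "pal_series 0" 1 L] p_recurrence[of 0 L]
      by (cases L) (auto simp: pal_series_def p_def)
  qed
  show "1 - fps_X \<noteq> (0 :: rat fps)" using one_minus_fps_X_power_neq_0[of 1] by simp
qed

lemma pal_series_1: "pal_series 1 = fps_X / (1 - fps_X ^ 2)"
proof (rule fps_eq_divideI)
  show "pal_series 1 * (1 - fps_X ^ 2) = fps_X"
  proof (rule fps_ext)
    fix L
    show "fps_nth (pal_series 1 * (1 - fps_X ^ 2)) L = fps_nth fps_X L"
      \<comment> \<open>For \<open>h = 1\<close> and \<open>L > 0\<close> the difference with lag 2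
        is \<open>p 0 (L - 1)\<close>, which is 1 only at \<open>L = 1\<close>.\<close>
      unfolding fps_nth_mult_one_minus_X_power
      using p_recurrence[of 1 L]
      by (cases "L = 0"; cases "L = 1") (auto simp: pal_series_def p_def[of 0] p_def[of "-1"] of_nat_diff)
  qed
qed (rule one_minus_fps_X_power_neq_0, simp)

text \<open>The term \<open>p (L - h - 1) h\<close> of the recurrence gives the factor
  \<open>1 - fps_X ^ (h + 1)\<close>, and \<open>p (h - 1) (L - h)\<close> gives a periodic series
  shifted by \<open>h\<close>. The recurrence starts at \<open>L = h\<close>, so smaller
  \<open>L\<close> contribute the polynomial \<open>?A\<close>.\<close>

lemma pal_series_ge_2:
  assumes "h \<ge> 2"
  shows "pal_series h =
           1 / (1 - fps_X ^ (h + 1)) *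
           ((\<Sum>L = 0..h - 1. of_nat (p (int L) (int h)) * fps_X ^ L)
            + fps_X ^ h / (1 - fps_X ^ (h - 1)) *
              (\<Sum>r = 0..h - 2. of_nat (p (int h - 1) (int r)) * fps_X ^ r))"
    (is "_ = 1 / ?D * (?A + fps_X ^ h / ?E * ?B)")
proof -
  have unit: "fps_nth ?D 0 \<noteq> (0::rat)" "fps_nth ?E 0 \<noteq> (0::rat)" using assms by auto
  define Q :: "rat fps" where "Q = Abs_fps (\<lambda>s. of_nat (p (int h - 1) (int s)))"
  have "Q * ?E = ?B"
  proof (rule fps_ext)
    fix s
    have "p (int h - 1) (int (s - (h - 1))) = p (int h - 1) (int s)" if "\<not> s < h - 1"
      using p_minus_period[of "int h - 1" "int s"] that assms
      by (simp add: of_nat_diff algebra_simps)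
    then show "fps_nth (Q * ?E) s = fps_nth ?B s"
      unfolding fps_nth_mult_one_minus_X_power fps_nth_sum_monomials
      using assms by (auto simp: Q_def)
  qed
  then have "Q = ?B * inverse ?E" using unit(2) by (rule fps_eq_mult_inverseI)
  then have Q: "fps_X ^ h / ?E * ?B = fps_X ^ h * Q" using unit
    by (simp add: fps_divide_unit mult_ac)
  have "pal_series h * ?D = ?A + fps_X ^ h * Q"
  proof (rule fps_ext)
    fix L
    \<comment> \<open>At \<open>L = h\<close> the lagged term is \<open>p (-1) h = 0\<close>, which
      agrees with the branch \<open>L < h + 1\<close>.\<close>
    have "p (int L) (int h) = p (int h - 1) (int (L - h))
        + (if L < h + 1 then 0 else p (int (L - (h + 1))) (int h))" if "h \<le> L"
      using p_recurrence[of h L] that assms p_neg by (auto simp: of_nat_diff algebra_simps)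
    then show "fps_nth (pal_series h * ?D) L = fps_nth (?A + fps_X ^ h * Q) L"
      unfolding fps_nth_mult_one_minus_X_power fps_add_nth fps_nth_sum_monomials
        fps_X_power_mult_nth
      using assms by (auto simp: Q_def pal_series_def)
  qed
  then have "pal_series h = (?A + fps_X ^ h * Q) * inverse ?D"
    using unit(1) by (rule fps_eq_mult_inverseI)
  then show ?thesis using unit unfolding Q by (simp add: fps_divide_unit mult_ac)
qed

theorem theorem21:
  shows "pal_series 0 = 1 / (1 - fps_X)
    \<and> pal_series 1 = fps_X / (1 - fps_X ^ 2)
    \<and> (\<forall>h::nat. h \<ge> 2 \<longrightarrow>
         pal_series h =
           1 / (1 - fps_X ^ (h + 1)) *
           ((\<Sum>L = 0..h - 1. of_nat (p (int L) (int h)) * fps_X ^ L)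
            + fps_X ^ h / (1 - fps_X ^ (h - 1)) *
              (\<Sum>r = 0..h - 2. of_nat (p (int h - 1) (int r)) * fps_X ^ r)))"
  using pal_series_0 pal_series_1 pal_series_ge_2 by blast

end
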